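(* Let $Z = Z_S + Z_C$ be the conditioning vector in $\mathbb{R}^d$, generated as the direct sum of independent encoded factors $Z_S$ and $Z_C$ as described in the context, where $Z_S = 0$ whenever $Y=0$. Let $E:\mathbb{R}^d\to\mathbb{R}^d\times\mathbb{R}^d$ be a (deterministic, measurable) map and set $(\hat Z_S,\hat Z_C) := E(Z)$. Suppose that: 1. (Additive reconstruction) $\hat Z_S + \hat Z_C = Z$ almost surely; 2. (Pinning) almost surely, $Y = 0 \Longleftrightarrow \hat Z_S = 0$; 3. (Independence) $\hat Z_S$ and $\hat Z_C$ are independent. Then $\hat Z_S = Z_S$ and $\hat Z_C = Z_C$ almost surely.
   Context: All random variables live on a common probability space. $S$ (the salient factor) is a random vector with values in a set $\mathcal{S}\subset\mathbb{R}^{d_S}$ containing $0$, $C$ (the common factor) is a random vector with values in $\mathcal{C}\subset\mathbb{R}^{d_C}$, and $S$ and $C$ are independent. The binary label is $Y\in\{0,1\}$ with $Y=0$ (a "background" sample) if and only if $S=0$, that is, $Y=\mathbf{1}\{S\neq 0\}$. It is assumed that $\mathbb{P}(Y=0)>0$. There are linear subspaces $V_S, V_C\subset\mathbb{R}^d$ with $\mathbb{R}^d = V_S\oplus V_C$ (direct sum), and measurable maps $\varphi_S:\mathcal{S}\to V_S$ and $\varphi_C:\mathcal{C}\to V_C$ with $\varphi_S(0)=0$. The encoded factors are $Z_S:=\varphi_S(S)$ and $Z_C:=\varphi_C(C)$ (hence independent, and $Z_S=0$ when $Y=0$), and the conditioning vector is $Z:=Z_S+Z_C$. *)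

theory Defs
  imports "HOL-Probability.Probability"
begin

definition is_direct_sum :: "'a::real_vector set \<Rightarrow> 'a set \<Rightarrow> bool"
  where "is_direct_sum V W \<longleftrightarrow>
    subspace V \<and> subspace W \<and> {v + w | v w. v \<in> V \<and> w \<in> W} = UNIV \<and> V \<inter> W = {0}"

(* The library's indep_var forces both random variables to have the same value type.
   This version admits different types; the lemma below shows that it coincides with
   indep_var when the types agree. *)
definition (in prob_space) indep_rv ::
    "'b measure \<Rightarrow> ('a \<Rightarrow> 'b) \<Rightarrow> 'c measure \<Rightarrow> ('a \<Rightarrow> 'c) \<Rightarrow> bool"
  where "indep_rv N X K Y \<longleftrightarrow>
    random_variable N X \<and> random_variable K Y \<and>
    indep_set (sets (vimage_algebra (space M) X N)) (sets (vimage_algebra (space M) Y K))"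

lemma (in prob_space) indep_rv_eq_indep_var: "indep_rv N X K Y \<longleftrightarrow> indep_var N X K Y"
  by (simp add: indep_rv_def indep_var_eq sets_vimage_algebra)

end

theory Submission
  imports Defs
begin

text \<open>
  On the background event \<open>Z\<^sub>S = 0\<close>, reconstruction and pinning give \<open>Zhat\<^sub>C = Z\<^sub>C\<close>. Both
  \<open>Zhat\<^sub>C\<close> and \<open>Z\<^sub>C\<close> are independent of this event, which has positive probability, so they have
  the same law; in particular \<open>Zhat\<^sub>C\<close> lies in \<open>V\<^sub>C\<close> almost surely. Projecting \<open>Zhat\<^sub>S + Zhat\<^sub>C = Z\<close>
  along the direct sum yields \<open>Z\<^sub>C = W + Zhat\<^sub>C\<close>, where \<open>W\<close> is the \<open>V\<^sub>C\<close>-component of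
  \<open>Zhat\<^sub>S\<close> and hence independent of \<open>Zhat\<^sub>C\<close>. Adding \<open>W\<close> does not change the law of \<open>Zhat\<^sub>C\<close>, so the
  characteristic function of \<open>W\<close> is \<open>1\<close> near the origin, which forces \<open>W = 0\<close>.
\<close>

text \<open>For nonzero \<open>x\<close> and large \<open>n\<close> the argument
  \<open>d / (real n + 2) * \<bar>x\<bar>\<close> is positive and below 1, where cosine is strictly
  less than 1. Only countably many frequencies are used, so that the hypothesis can be obtained
  almost surely for all of them at once.\<close>

lemma eq_0_if_cos_eq_1_near_0:
  fixes x d :: real
  assumes d: "d > 0" and cos1: "\<And>n::nat. cos (d / (real n + 2) * x) = 1"
  shows "x = 0"
proof (rule ccontr)
  assume x: "x \<noteq> 0"
  obtain n :: nat where n: "d * \<bar>x\<bar> < real n" using reals_Archimedean2 by blast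
  define y where "y = d / (real n + 2) * \<bar>x\<bar>"
  have "d * \<bar>x\<bar> < 1 * (real n + 2)" using n by simp
  then have "y < 1" unfolding y_def by (simp add: field_simps)
  then have y: "0 < y" "y \<le> pi" using d x pi_gt3 by (simp add: y_def, linarith)
  have "cos y < cos 0" using y by (intro cos_monotone_0_pi) auto
  moreover have "cos y = cos (d / (real n + 2) * x)"
    unfolding y_def by (cases "x \<ge> 0") auto
  ultimately show False using cos1[of n] by simp
qed

context prob_space
begin

text \<open>Taking real parts, the expectation of the nonnegative variable
  \<open>1 - cos (t * X \<omega>)\<close> is 0, so this variable vanishes almost surely.\<close>

lemma AE_cos_eq_1_if_char_eq_1:
  fixes X :: "'a \<Rightarrow> real"
  assumes X[measurable]: "X \<in> borel_measurable M"
    and char1: "char (distr M borel X) t = 1"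
  shows "AE \<omega> in M. cos (t * X \<omega>) = 1"
proof -
  have int: "integrable M (\<lambda>\<omega>. iexp (t * X \<omega>))"
    using integrable_iexp[of "\<lambda>\<omega>. complex_of_real (t * X \<omega>)"] by simp
  have "(CLINT \<omega>|M. iexp (t * X \<omega>)) = 1"
    using char1 unfolding char_def by (subst (asm) integral_distr) auto
  then have "Re (CLINT \<omega>|M. iexp (t * X \<omega>)) = 1" by simp
  then have "(\<integral>\<omega>. Re (iexp (t * X \<omega>)) \<partial>M) = 1"
    by (subst integral_Re[OF int])
  then have cos1: "(\<integral>\<omega>. cos (t * X \<omega>) \<partial>M) = 1" by (simp add: Re_exp)
  have intc: "integrable M (\<lambda>\<omega>. cos (t * X \<omega>))"
    by (rule integrable_const_bound[of _ 1]) auto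
  have "(\<integral>\<omega>. 1 - cos (t * X \<omega>) \<partial>M) = 0"
    using cos1 intc by (simp add: prob_space)
  then have "AE \<omega> in M. 1 - cos (t * X \<omega>) = 0"
    using intc by (subst (asm) integral_nonneg_eq_0_iff_AE) auto
  then show ?thesis by simp
qed

text \<open>By independence the characteristic function of the sum is a product, so that of
  \<open>X\<close> equals itself times that of \<open>W\<close>. Being continuous with value 1 at 0,
  it is nonzero near 0 and can be cancelled there.\<close>

lemma AE_eq_0_if_indep_add_same_distr_real:
  fixes W X :: "'a \<Rightarrow> real"
  assumes ind: "indep_var borel W borel X"
    and eq: "distr M borel (\<lambda>\<omega>. W \<omega> + X \<omega>) = distr M borel X"
  shows "AE \<omega> in M. W \<omega> = 0"
proof -
  have [measurable]: "W \<in> borel_measurable M" "X \<in> borel_measurable M"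
    using ind by (auto dest: indep_var_rv1 indep_var_rv2)
  interpret X: real_distribution "distr M borel X" by simp
  let ?c = "char (distr M borel X)"
  have "\<forall>\<^sub>F t in at 0. ?c t \<noteq> 0"
    using X.isCont_char[of 0] X.char_zero
    by (intro tendsto_imp_eventually_ne[where c = 1]) (auto simp: isCont_def)
  then obtain d where d: "d > 0" "\<And>t. t \<noteq> 0 \<Longrightarrow> dist t 0 < d \<Longrightarrow> ?c t \<noteq> 0"
    unfolding eventually_at by auto
  have "AE \<omega> in M. \<forall>n::nat. cos (d / (real n + 2) * W \<omega>) = 1"
    unfolding AE_all_countable
  proof
    fix n :: nat
    let ?t = "d / (real n + 2)"
    \<comment> \<open>The offset 2 puts every frequency strictly inside the radius \<open>d\<close>,
      including the one for \<open>n = 0\<close>.\<close>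
    have "d * 1 < d * (real n + 2)" using d(1) by (intro mult_strict_left_mono) auto
    then have "?c ?t \<noteq> 0" using d(1) by (intro d(2)) (auto simp: field_simps)
    moreover have "?c ?t = char (distr M borel W) ?t * ?c ?t"
      using char_distr_add[OF ind, of ?t] eq by simp
    ultimately have "char (distr M borel W) ?t = 1" by simp
    then show "AE \<omega> in M. cos (?t * W \<omega>) = 1"
      by (intro AE_cos_eq_1_if_char_eq_1) auto
  qed
  then show ?thesis
    by eventually_elim (rule eq_0_if_cos_eq_1_near_0[OF d(1)], blast)
qed

text \<open>Taking a coordinate preserves both independence and equality of laws, so the real case
  applies to each of the finitely many coordinates.\<close>

lemma AE_eq_0_if_indep_add_same_distr:
  fixes W X :: "'a \<Rightarrow> 'b::euclidean_space"
  assumes ind: "indep_var borel W borel X"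
    and eq: "distr M borel (\<lambda>\<omega>. W \<omega> + X \<omega>) = distr M borel X"
  shows "AE \<omega> in M. W \<omega> = 0"
proof -
  have [measurable]: "W \<in> borel_measurable M" "X \<in> borel_measurable M"
    using ind by (auto dest: indep_var_rv1 indep_var_rv2)
  have "AE \<omega> in M. \<forall>b\<in>Basis. W \<omega> \<bullet> b = 0"
  proof (rule AE_finite_allI)
    fix b :: 'b
    have ind': "indep_var borel (\<lambda>\<omega>. W \<omega> \<bullet> b) borel (\<lambda>\<omega>. X \<omega> \<bullet> b)"
      using indep_var_compose[OF ind, of "\<lambda>x. x \<bullet> b" borel "\<lambda>x. x \<bullet> b" borel]
      by (simp add: comp_def)
    have "distr (distr M borel (\<lambda>\<omega>. W \<omega> + X \<omega>)) borel (\<lambda>x. x \<bullet> b) =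
        distr (distr M borel X) borel (\<lambda>x. x \<bullet> b)"
      by (simp only: eq)
    then have "distr M borel (\<lambda>\<omega>. W \<omega> \<bullet> b + X \<omega> \<bullet> b) = distr M borel (\<lambda>\<omega>. X \<omega> \<bullet> b)"
      by (simp add: distr_distr comp_def inner_add_left)
    with ind' show "AE \<omega> in M. W \<omega> \<bullet> b = 0"
      by (rule AE_eq_0_if_indep_add_same_distr_real)
  qed simp
  then show ?thesis
    by eventually_elim (simp only: euclidean_all_zero_iff)
qed

text \<open>Conditioned on the event, \<open>X\<close> and \<open>X'\<close> have the same law, and
  by independence each conditional law is the unconditional one. Two almost surely equal events are
  allowed because each variable may come with its own version of the event.\<close>

lemma distr_eq_if_eq_on_indep_event:
  assumes X: "X \<in> measurable M N" and X': "X' \<in> measurable M N"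
    and F: "F \<in> events" "prob F > 0" and F': "F' \<in> events"
    and FF': "AE \<omega> in M. \<omega> \<in> F \<longleftrightarrow> \<omega> \<in> F'"
    and eq: "AE \<omega> in M. \<omega> \<in> F \<longrightarrow> X \<omega> = X' \<omega>"
    and indX: "\<And>A. A \<in> sets N \<Longrightarrow>
      prob (F \<inter> (X -` A \<inter> space M)) = prob F * prob (X -` A \<inter> space M)"
    and indX': "\<And>A. A \<in> sets N \<Longrightarrow>
      prob (F' \<inter> (X' -` A \<inter> space M)) = prob F' * prob (X' -` A \<inter> space M)"
  shows "distr M N X = distr M N X'"
proof (rule measure_eqI)
  fix A assume "A \<in> sets (distr M N X)"
  then have A: "A \<in> sets N" by simp
  have ev: "X -` A \<inter> space M \<in> events" "X' -` A \<inter> space M \<in> events"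
    using X X' A by (auto intro: measurable_sets)
  have "prob F * prob (X -` A \<inter> space M) = prob (F \<inter> (X -` A \<inter> space M))"
    using indX[OF A] by simp
  also have "\<dots> = prob (F' \<inter> (X' -` A \<inter> space M))"
  proof (rule finite_measure_eq_AE)
    show "AE \<omega> in M. \<omega> \<in> F \<inter> (X -` A \<inter> space M) \<longleftrightarrow> \<omega> \<in> F' \<inter> (X' -` A \<inter> space M)"
      using FF' eq by eventually_elim auto
  qed (use F F' ev in auto)
  also have "\<dots> = prob F' * prob (X' -` A \<inter> space M)" by (rule indX'[OF A])
  also have "prob F' = prob F"
    using FF' F(1) F' by (intro finite_measure_eq_AE) auto
  finally have "prob (X -` A \<inter> space M) = prob (X' -` A \<inter> space M)"
    using F(2) by simp
  then show "emeasure (distr M N X) A = emeasure (distr M N X') A"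
    using X X' A by (simp add: emeasure_distr emeasure_eq_measure)
qed simp

end

text \<open>\<open>P\<close> is the projection onto \<open>V\<close> along \<open>W\<close>. Trivial
  intersection makes the \<open>V\<close>-component unique, and linearity follows by exhibiting the
  expected value as such a component.\<close>

lemma is_direct_sum_projection:
  assumes "is_direct_sum V W"
  obtains P where "linear P" "\<And>v w. v \<in> V \<Longrightarrow> w \<in> W \<Longrightarrow> P (v + w) = v"
proof -
  have V: "subspace V" and W: "subspace W" and VW: "V \<inter> W = {0}"
    and sum: "{v + w | v w. v \<in> V \<and> w \<in> W} = UNIV"
    using assms by (auto simp: is_direct_sum_def)
  have "\<exists>v. v \<in> V \<and> x - v \<in> W" for x
  proof -
    have "x \<in> {v + w | v w. v \<in> V \<and> w \<in> W}" using sum by simp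
    then obtain v w where "x = v + w" "v \<in> V" "w \<in> W" by blast
    then show ?thesis by (intro exI[of _ v]) auto
  qed
  then obtain P where P: "\<And>x. P x \<in> V" "\<And>x. x - P x \<in> W" by metis
  have unique: "P x = v" if "v \<in> V" "x - v \<in> W" for x v
  proof -
    have "P x - v \<in> V" using V P(1) that(1) by (rule subspace_diff)
    moreover have "(x - v) - (x - P x) \<in> W" using W that(2) P(2) by (rule subspace_diff)
    then have "P x - v \<in> W" by simp
    ultimately have "P x - v \<in> {0}" unfolding VW[symmetric] by (rule IntI)
    then show ?thesis by simp
  qed
  have "linear P"
  proof (rule linearI)
    fix x y
    have "(x - P x) + (y - P y) \<in> W" using W P(2) P(2) by (rule subspace_add)
    then show "P (x + y) = P x + P y"
      by (intro unique subspace_add[OF V P(1) P(1)]) (simp add: algebra_simps)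
  next
    fix c x
    have "c *\<^sub>R (x - P x) \<in> W" using W P(2) by (rule subspace_scale)
    then show "P (c *\<^sub>R x) = c *\<^sub>R P x"
      by (intro unique subspace_scale[OF V P(1)]) (simp add: algebra_simps)
  qed
  moreover have "P (v + w) = v" if "v \<in> V" "w \<in> W" for v w
    using that by (intro unique) auto
  ultimately show thesis using that by blast
qed

theorem theorem1:
  fixes M :: "'w measure"
    and S :: "'w \<Rightarrow> real ^ 'ds" and C :: "'w \<Rightarrow> real ^ 'dc"
    and SS :: "(real ^ 'ds) set" and CC :: "(real ^ 'dc) set"
    and Y :: "'w \<Rightarrow> nat"
    and V\<^sub>S V\<^sub>C :: "(real ^ 'd) set"
    and \<phi>\<^sub>S :: "real ^ 'ds \<Rightarrow> real ^ 'd" and \<phi>\<^sub>C :: "real ^ 'dc \<Rightarrow> real ^ 'd"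
    and Z\<^sub>S Z\<^sub>C Z :: "'w \<Rightarrow> real ^ 'd"
    and E :: "real ^ 'd \<Rightarrow> (real ^ 'd) \<times> (real ^ 'd)"
    and Zhat\<^sub>S Zhat\<^sub>C :: "'w \<Rightarrow> real ^ 'd"
  assumes prob: "prob_space M"
    and SS0: "0 \<in> SS"
    and S_rv: "S \<in> measurable M (restrict_space borel SS)"
    and C_rv: "C \<in> measurable M (restrict_space borel CC)"
    and S_C_indep: "prob_space.indep_rv M borel S borel C"
    and Y_def: "\<forall>\<omega>\<in>space M. Y \<omega> = (if S \<omega> \<noteq> 0 then 1 else 0)"
    and Y_pos: "measure M {\<omega> \<in> space M. Y \<omega> = 0} > 0"
    and direct_sum: "is_direct_sum V\<^sub>S V\<^sub>C"
    and phiS: "\<phi>\<^sub>S \<in> measurable (restrict_space borel SS) (restrict_space borel V\<^sub>S)"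
    and phiC: "\<phi>\<^sub>C \<in> measurable (restrict_space borel CC) (restrict_space borel V\<^sub>C)"
    and phiS0: "\<phi>\<^sub>S 0 = 0"
    and ZS_def: "\<forall>\<omega>\<in>space M. Z\<^sub>S \<omega> = \<phi>\<^sub>S (S \<omega>)"
    and ZC_def: "\<forall>\<omega>\<in>space M. Z\<^sub>C \<omega> = \<phi>\<^sub>C (C \<omega>)"
    and Z_def: "\<forall>\<omega>\<in>space M. Z \<omega> = Z\<^sub>S \<omega> + Z\<^sub>C \<omega>"
    and E_meas: "E \<in> measurable borel (borel \<Otimes>\<^sub>M borel)"
    and Zhat_def: "\<forall>\<omega>\<in>space M. (Zhat\<^sub>S \<omega>, Zhat\<^sub>C \<omega>) = E (Z \<omega>)"
    and additive_reconstruction: "AE \<omega> in M. Zhat\<^sub>S \<omega> + Zhat\<^sub>C \<omega> = Z \<omega>"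
    and pinning: "AE \<omega> in M. Y \<omega> = 0 \<longleftrightarrow> Zhat\<^sub>S \<omega> = 0"
    and independence: "prob_space.indep_var M borel Zhat\<^sub>S borel Zhat\<^sub>C"
  shows "(AE \<omega> in M. Zhat\<^sub>S \<omega> = Z\<^sub>S \<omega>) \<and> (AE \<omega> in M. Zhat\<^sub>C \<omega> = Z\<^sub>C \<omega>)"
proof -
  interpret prob_space M by (rule prob)
  have [measurable]: "Zhat\<^sub>S \<in> borel_measurable M" "Zhat\<^sub>C \<in> borel_measurable M"
    using independence by (auto dest: indep_var_rv1 indep_var_rv2)
  have S_meas[measurable]: "S \<in> borel_measurable M" and S_SS: "\<And>\<omega>. \<omega> \<in> space M \<Longrightarrow> S \<omega> \<in> SS"
    using S_rv by (auto simp: measurable_restrict_space2_iff)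
  have C_CC: "\<And>\<omega>. \<omega> \<in> space M \<Longrightarrow> C \<omega> \<in> CC"
    using C_rv by (auto simp: measurable_restrict_space2_iff)
  have ZC_VC: "Z\<^sub>C \<omega> \<in> V\<^sub>C" if "\<omega> \<in> space M" for \<omega>
    using that ZC_def C_CC phiC by (auto simp: measurable_restrict_space2_iff space_restrict_space)
  have ZS_VS: "Z\<^sub>S \<omega> \<in> V\<^sub>S" if "\<omega> \<in> space M" for \<omega>
    using that ZS_def S_SS phiS by (auto simp: measurable_restrict_space2_iff space_restrict_space)
  have "(\<lambda>\<omega>. \<phi>\<^sub>C (C \<omega>)) \<in> borel_measurable M"
    using measurable_comp[OF C_rv phiC] by (simp add: measurable_restrict_space2_iff comp_def)
  then have ZC_meas[measurable]: "Z\<^sub>C \<in> borel_measurable M"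
    using ZC_def by (subst measurable_cong[where g = "\<lambda>\<omega>. \<phi>\<^sub>C (C \<omega>)"]) auto
  have indep_SC: "indep_set (sets (vimage_algebra (space M) S borel))
      (sets (vimage_algebra (space M) C borel))"
    using S_C_indep by (simp add: indep_rv_def)

  have Y_0: "Y \<omega> = 0 \<longleftrightarrow> S \<omega> = 0" if "\<omega> \<in> space M" for \<omega>
    using Y_def that by simp
  \<comment> \<open>Both are the background event up to a null set: \<open>F\<close> is expressed
    through \<open>Zhat\<^sub>S\<close>, hence independent of \<open>Zhat\<^sub>C\<close>, and
    \<open>F'\<close> through \<open>S\<close>, hence independent of
    \<open>Z\<^sub>C\<close>.\<close>
  define F where "F = Zhat\<^sub>S -` {0} \<inter> space M"
  define F' where "F' = S -` {0} \<inter> space M"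
  have F_ev: "F \<in> events" "F' \<in> events" unfolding F_def F'_def by measurable
  have F'_pos: "prob F' > 0"
  proof -
    have "{\<omega> \<in> space M. Y \<omega> = 0} = F'" using Y_0 by (auto simp: F'_def)
    then show ?thesis using Y_pos by simp
  qed
  have FF': "AE \<omega> in M. \<omega> \<in> F' \<longleftrightarrow> \<omega> \<in> F"
    using pinning AE_space by eventually_elim (use Y_0 in \<open>auto simp: F_def F'_def\<close>)
  have law: "distr M borel Z\<^sub>C = distr M borel Zhat\<^sub>C"
  proof (rule distr_eq_if_eq_on_indep_event[OF _ _ F_ev(2) F'_pos F_ev(1) FF'])
    \<comment> \<open>On the background both \<open>Z\<^sub>S = \<phi>\<^sub>S 0 = 0\<close> and
      \<open>Zhat\<^sub>S = 0\<close>, so \<open>Z\<close> equals \<open>Z\<^sub>C\<close> as well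
      as \<open>Zhat\<^sub>C\<close>.\<close>
    show "AE \<omega> in M. \<omega> \<in> F' \<longrightarrow> Z\<^sub>C \<omega> = Zhat\<^sub>C \<omega>"
      using FF' additive_reconstruction AE_space
      by eventually_elim (use Z_def ZS_def phiS0 in \<open>auto simp: F_def F'_def\<close>)
  next
    fix A :: "(real ^ 'd) set" assume A: "A \<in> sets borel"
    have "\<phi>\<^sub>C \<in> borel_measurable (restrict_space borel CC)"
      using phiC by (simp add: measurable_restrict_space2_iff)
    then have "\<phi>\<^sub>C -` A \<inter> CC \<in> sets (restrict_space borel CC)"
      using A by (auto dest: measurable_sets simp: space_restrict_space)
    \<comment> \<open>Measurability of the encoder is relative to \<open>CC\<close>, so its preimage
      of \<open>A\<close> is only the trace on \<open>CC\<close> of a Borel set \<open>B\<close>. As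
      \<open>C\<close> takes values in \<open>CC\<close>, the event for \<open>Z\<^sub>C\<close> is
      still the preimage of \<open>B\<close> under \<open>C\<close>.\<close>
    then obtain B where B: "B \<in> sets borel" "\<phi>\<^sub>C -` A \<inter> CC = CC \<inter> B"
      by (auto simp: sets_restrict_space)
    have "Z\<^sub>C -` A \<inter> space M = C -` B \<inter> space M"
      using B(2) C_CC ZC_def by auto
    then have "Z\<^sub>C -` A \<inter> space M \<in> sets (vimage_algebra (space M) C borel)"
      using B(1) by (auto intro: in_vimage_algebra)
    moreover have "F' \<in> sets (vimage_algebra (space M) S borel)"
      unfolding F'_def by (auto intro: in_vimage_algebra)
    ultimately show "prob (F' \<inter> (Z\<^sub>C -` A \<inter> space M)) = prob F' * prob (Z\<^sub>C -` A \<inter> space M)"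
      by (intro indep_setD[OF indep_SC])
  next
    fix A :: "(real ^ 'd) set" assume A: "A \<in> sets borel"
    have "(\<lambda>\<omega>. (Zhat\<^sub>S \<omega>, Zhat\<^sub>C \<omega>)) -` ({0} \<times> A) \<inter> space M = F \<inter> (Zhat\<^sub>C -` A \<inter> space M)"
      by (auto simp: F_def)
    then show "prob (F \<inter> (Zhat\<^sub>C -` A \<inter> space M)) = prob F * prob (Zhat\<^sub>C -` A \<inter> space M)"
      using indep_varD[OF independence, of "{0}" A] A by (simp add: F_def)
  qed auto

  obtain P where P: "linear P" "\<And>v w. v \<in> V\<^sub>S \<Longrightarrow> w \<in> V\<^sub>C \<Longrightarrow> P (v + w) = v"
    using is_direct_sum_projection[OF direct_sum] by blast
  have subVS: "subspace V\<^sub>S" and subVC: "subspace V\<^sub>C"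
    using direct_sum by (auto simp: is_direct_sum_def)
  have P_VC: "P v = 0" if "v \<in> V\<^sub>C" for v
    using P(2)[OF subspace_0[OF subVS] that] by simp
  have [measurable]: "V\<^sub>C \<in> sets borel" using closed_subspace[OF subVC] by simp
  have [measurable]: "P \<in> borel_measurable borel"
    using P(1) by (intro borel_measurable_continuous_onI linear_continuous_on)
      (simp add: linear_conv_bounded_linear)
  \<comment> \<open>Membership in \<open>V\<^sub>C\<close> depends only on the law, since a subspace
    is closed and hence Borel; it passes from \<open>Z\<^sub>C\<close> to
    \<open>Zhat\<^sub>C\<close>.\<close>
  have "AE x in distr M borel Zhat\<^sub>C. x \<in> V\<^sub>C"
    unfolding law[symmetric] using ZC_VC by (subst AE_distr_iff) auto
  then have Zhat_VC: "AE \<omega> in M. Zhat\<^sub>C \<omega> \<in> V\<^sub>C"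
    by (subst (asm) AE_distr_iff) auto
  \<comment> \<open>\<open>P\<close> kills \<open>Zhat\<^sub>C\<close>, so applying it to the
    reconstruction identity leaves the salient component of \<open>Z\<close>.\<close>
  have P_Zhat: "AE \<omega> in M. P (Zhat\<^sub>S \<omega>) = Z\<^sub>S \<omega>"
    using Zhat_VC additive_reconstruction AE_space
  proof eventually_elim
    case (elim \<omega>)
    have "P (Zhat\<^sub>S \<omega>) = P (Zhat\<^sub>S \<omega> + Zhat\<^sub>C \<omega>)"
      using elim(1) by (simp add: linear_add[OF P(1)] P_VC)
    also have "\<dots> = P (Z\<^sub>S \<omega> + Z\<^sub>C \<omega>)" using elim Z_def by simp
    also have "\<dots> = Z\<^sub>S \<omega>" using elim(3) by (intro P(2) ZS_VS ZC_VC)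
    finally show ?case .
  qed
  define W where "W \<omega> = Zhat\<^sub>S \<omega> - P (Zhat\<^sub>S \<omega>)" for \<omega>
  have [measurable]: "W \<in> borel_measurable M" unfolding W_def by measurable
  \<comment> \<open>\<open>W\<close> is a measurable function of \<open>Zhat\<^sub>S\<close> alone
    and so inherits its independence of \<open>Zhat\<^sub>C\<close>.\<close>
  have "indep_var borel ((\<lambda>x. x - P x) \<circ> Zhat\<^sub>S) borel (id \<circ> Zhat\<^sub>C)"
    by (rule indep_var_compose[OF independence]) auto
  then have "indep_var borel W borel Zhat\<^sub>C"
    unfolding W_def[abs_def] comp_def id_def .
  moreover have W_add: "AE \<omega> in M. W \<omega> + Zhat\<^sub>C \<omega> = Z\<^sub>C \<omega>"
    using P_Zhat additive_reconstruction AE_space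
  proof eventually_elim
    case (elim \<omega>)
    have "W \<omega> + Zhat\<^sub>C \<omega> = (Zhat\<^sub>S \<omega> + Zhat\<^sub>C \<omega>) - P (Zhat\<^sub>S \<omega>)"
      by (simp add: W_def)
    also have "\<dots> = Z \<omega> - Z\<^sub>S \<omega>" unfolding elim(1,2) ..
    also have "\<dots> = Z\<^sub>C \<omega>" using elim(3) Z_def by simp
    finally show ?case .
  qed
  then have "distr M borel (\<lambda>\<omega>. W \<omega> + Zhat\<^sub>C \<omega>) = distr M borel Zhat\<^sub>C"
    unfolding law[symmetric] by (intro distr_cong_AE) auto
  ultimately have W0: "AE \<omega> in M. W \<omega> = 0"
    by (rule AE_eq_0_if_indep_add_same_distr)
  \<comment> \<open>With \<open>W = 0\<close>, \<open>Zhat\<^sub>S\<close> coincides with its own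
    projection, already identified as \<open>Z\<^sub>S\<close>.\<close>
  have "AE \<omega> in M. Zhat\<^sub>S \<omega> = Z\<^sub>S \<omega>"
    using W0 P_Zhat unfolding W_def by eventually_elim (metis eq_iff_diff_eq_0)
  moreover have "AE \<omega> in M. Zhat\<^sub>C \<omega> = Z\<^sub>C \<omega>"
    using W0 W_add by eventually_elim simp
  ultimately show ?thesis by blast
qed

end
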